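(* For every even integer $d>4$, the number $\frac{d}{2}\binom{d}{d/2}-1$ is a gap in the vertex slice sequence of the $d$-dimensional hypercube $Q_d$.
   Context: $Q_d$ is the convex hull of the $2^d$ points of $\mathbb{R}^d$ all of whose coordinates are $0$ or $1$. For a $d$-dimensional convex polytope $P\subset\mathbb{R}^d$, let $\mathcal{H}_P$ be the set of affine hyperplanes $H$ with $H\cap P\neq\emptyset$, let $cv_P(H)=|V(H\cap P)|$ be the number of vertices of $H\cap P$, and $\nu(P)=\max_{H\in\mathcal{H}_P}cv_P(H)$. The vertex slice sequence of $P$ is the set of values $cv_P(\mathcal{H}_P)$. A gap of $P$ is an integer $m$ with $1\le m\le\nu(P)$ that is not in the vertex slice sequence. *)

theory Defs
  imports "HOL-Analysis.Analysis"
begin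

definition hypercube :: "(real ^ 'n) set" where
  "hypercube = convex hull {x. \<forall>i. x $ i = 0 \<or> x $ i = 1}"

definition hyperplanes_meeting :: "'a::euclidean_space set \<Rightarrow> 'a set set" where
  "hyperplanes_meeting P = {H. (\<exists>a b. a \<noteq> 0 \<and> H = {x. a \<bullet> x = b}) \<and> H \<inter> P \<noteq> {}}"

text \<open>The vertices of a convex polytope are its extreme points. For a polytope \<open>P\<close> the slice
  \<open>H \<inter> P\<close> is again a polytope, so the set whose cardinality is taken is finite.\<close>

definition polytope_vertices :: "'a::euclidean_space set \<Rightarrow> 'a set" where
  "polytope_vertices P = {v. v extreme_point_of P}"

definition cv :: "'a::euclidean_space set \<Rightarrow> 'a set \<Rightarrow> nat" where
  "cv P H = card (polytope_vertices (H \<inter> P))"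

definition vertex_slice_sequence :: "'a::euclidean_space set \<Rightarrow> nat set" where
  "vertex_slice_sequence P = cv P ` hyperplanes_meeting P"

text \<open>For a polytope \<open>P\<close> the vertex slice sequence is finite: each vertex of \<open>H \<inter> P\<close> is
  a vertex of \<open>P\<close> or the only point of \<open>H\<close> on some edge of \<open>P\<close>. So the maximum exists
  whenever \<open>P\<close> is also nonempty and the space is not zero-dimensional.\<close>

definition max_vertex_slice :: "'a::euclidean_space set \<Rightarrow> nat" where
  "max_vertex_slice P = Max (vertex_slice_sequence P)"

definition is_gap :: "'a::euclidean_space set \<Rightarrow> nat \<Rightarrow> bool" where
  "is_gap P m \<longleftrightarrow> 1 \<le> m \<and> m \<le> max_vertex_slice P \<and> m \<notin> vertex_slice_sequence P"

end

theory Submission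
  imports Defs "HOL-Combinatorics.Multiset_Permutations"
begin

text \<open>Write \<open>d = 2 * h\<close> and \<open>M = h * (2 * h choose h)\<close>, and identify the corners of the cube with the
  subsets \<open>S\<close> of the coordinates. The vertices of the slice by \<open>{x. a \<bullet> x = b}\<close> are the corners on
  the hyperplane and the interior points in which it crosses an edge, so the number of vertices of
  the slice is the number of zeros plus the number of sign-changing edges of \<open>f S = a(S) - b\<close>
  (\<open>cv_eq_zeros_sign_changes\<close>).

  The number \<open>M\<close> is a value of this count, attained halfway between the two levels \<open>h - 1\<close> and \<open>h\<close>
  (\<open>card_zeros_sign_changes_middle\<close>), and it is even. The odd number \<open>M - 1\<close> is missed for three
  reasons, according to the hyperplane.

  \<^item> If some weight \<open>a\<^sub>i\<close> is 0, the slice is a prism and its number of vertices is even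
    (\<open>even_card_zeros_sign_changes_toggle\<close>).

  \<^item> If the hyperplane contains no corner, the vertices of the slice correspond to the edge boundary
    of \<open>{S. f S < 0}\<close> in a graph all of whose degrees are the even number \<open>d\<close>; such a boundary is
    even (\<open>even_card_sign_changes\<close>).

  \<^item> Otherwise all weights are nonzero, and positive after reflecting some coordinates, and there are
    \<open>e \<ge> 1\<close> corners on the hyperplane. Then \<open>f\<close> is strictly increasing, so every maximal chain of
    subsets meets at most one zero or sign-changing edge (\<open>LYM_zeros_sign_changes\<close>). Weighing zeros
    and edges by the number of chains through them shows that a zero takes the place of at least \<open>h\<close>
    edges: with \<open>c\<close> sign changes, \<open>h * e + c \<le> M\<close> (\<open>zeros_sign_changes_bound\<close>). So
    \<open>e + c \<le> M - (h - 1) * e \<le> M - 2\<close>, where the last step is \<open>d > 4\<close>.\<close>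

section \<open>Parity of the number of sign changes\<close>

lemma fixpoint_free_involution_even_card:
  assumes "finite A" and "\<And>x. x \<in> A \<Longrightarrow> h x \<in> A" and "\<And>x. x \<in> A \<Longrightarrow> h (h x) = x"
    and "\<And>x. x \<in> A \<Longrightarrow> h x \<noteq> x"
  shows "even (card A)"
proof -
  let ?C = "(\<lambda>x. {x, h x}) ` A"
  have "2 * card ?C = card (\<Union>?C)"
  proof (rule card_partition)
    show "finite ?C" "finite (\<Union>?C)" using assms(1) by auto
    show "\<And>c. c \<in> ?C \<Longrightarrow> card c = 2"
      using assms(4) by (force simp: card_2_iff)
    show "c \<inter> c' = {}" if "c \<in> ?C" "c' \<in> ?C" "c \<noteq> c'" for c c'
      using that assms(3) by (auto, metis+)
  qed
  moreover have "\<Union>?C = A" using assms(2) by auto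
  ultimately show ?thesis by (metis dvd_triv_left)
qed

definition toggle :: "'a \<Rightarrow> 'a set \<Rightarrow> 'a set" where
  "toggle i S = (if i \<in> S then S - {i} else insert i S)"

lemma toggle_toggle [simp]: "toggle i (toggle i S) = S"
  by (auto simp: toggle_def)

lemma toggle_neq [simp]: "toggle i S \<noteq> S"
  by (auto simp: toggle_def)

text \<open>For \<open>f S = w(S) - b\<close> the zeros are the cube vertices on the hyperplane and the sign changes are
  the edges that it crosses in an interior point, each edge being named by its direction \<open>i\<close> and its
  end \<open>S\<close> that avoids \<open>i\<close>. Parity and the chain inequality depend on \<open>f\<close> only through symmetry,
  nonvanishing or monotonicity, so they are proved for arbitrary functions on the subsets.\<close>

definition zeros :: "('a set \<Rightarrow> real) \<Rightarrow> 'a set set" where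
  "zeros f = {S. f S = 0}"

definition sign_changes :: "('a set \<Rightarrow> real) \<Rightarrow> ('a \<times> 'a set) set" where
  "sign_changes f = {(i, S). i \<notin> S \<and> f S * f (insert i S) < 0}"

text \<open>The edge boundary of any vertex set \<open>L\<close> in a graph with even degrees is even: the degrees of the
  vertices in \<open>L\<close> add up to an even number, in which an edge inside \<open>L\<close> is counted twice and an
  edge that leaves \<open>L\<close> once. Without zeros, the edges that leave \<open>L = {S. f S < 0}\<close> are those on
  which \<open>f\<close> changes sign.\<close>

lemma even_card_sign_changes:
  fixes f :: "'a::finite set \<Rightarrow> real"
  assumes d: "even CARD('a)" and z: "zeros f = {}"
  shows "even (card (sign_changes f))"
proof -
  define L where "L = {S. f S < 0}"
  \<comment> \<open>An incidence is a pair of a vertex in \<open>L\<close> and a direction; \<open>outer\<close> holds the incidences of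
      boundary edges.\<close>
  define inner where "inner = {(i::'a, S). S \<in> L \<and> toggle i S \<in> L}"
  define outer where "outer = {(i::'a, S). S \<in> L \<and> toggle i S \<notin> L}"
  have pos: "f S > 0" if "S \<notin> L" for S
    using that z unfolding L_def zeros_def
    by (metis (mono_tags, lifting) empty_iff linorder_neqE_linordered_idom mem_Collect_eq)
  have "even (card inner)"
    by (rule fixpoint_free_involution_even_card[where h = "\<lambda>(i, S). (i, toggle i S)"])
      (auto simp: inner_def)
  moreover have "card inner + card outer = CARD('a) * card L"
  proof -
    have "inner \<union> outer = UNIV \<times> L" "inner \<inter> outer = {}"
      by (auto simp: inner_def outer_def)
    then show ?thesis
      by (metis card_Un_disjoint card_cartesian_product finite)
  qed
  moreover have "bij_betw (\<lambda>(i, S). (i, S - {i})) outer (sign_changes f)"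
  proof (rule bij_betw_byWitness[where f' = "\<lambda>(i, S). (i, if S \<in> L then S else insert i S)"])
    show "\<forall>p\<in>outer. (case case p of (i, S) \<Rightarrow> (i, S - {i}) of (i, S) \<Rightarrow> (i, if S \<in> L then S else insert i S)) = p"
      by (auto simp: outer_def toggle_def insert_absorb split: if_splits)
    show "\<forall>p\<in>sign_changes f. (case case p of (i, S) \<Rightarrow> (i, if S \<in> L then S else insert i S) of (i, S) \<Rightarrow> (i, S - {i})) = p"
      by (auto simp: sign_changes_def)
    show "(\<lambda>(i, S). (i, S - {i})) ` outer \<subseteq> sign_changes f"
    proof (clarsimp simp: outer_def sign_changes_def)
      fix i S assume S: "S \<in> L" "toggle i S \<notin> L"
      then have "f S < 0" "f (toggle i S) > 0" using pos by (auto simp: L_def)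
      then show "f (S - {i}) * f (insert i S) < 0"
        by (auto simp: toggle_def insert_absorb mult_less_0_iff split: if_splits)
    qed
    show "(\<lambda>(i, S). (i, if S \<in> L then S else insert i S)) ` sign_changes f \<subseteq> outer"
      by (auto simp: outer_def sign_changes_def toggle_def L_def mult_less_0_iff)
  qed
  then have "card outer = card (sign_changes f)" by (rule bij_betw_same_card)
  ultimately show ?thesis using d by (metis dvd_mult2 even_add)
qed

text \<open>This is the case of a hyperplane parallel to the \<open>i\<close>-th axis: its slice is a prism in that
  direction, and toggling \<open>i\<close> exchanges the two ends of the prism. No edge in direction \<open>i\<close> itself
  changes sign, so the exchange is defined on all the edges that count.\<close>

lemma even_card_zeros_sign_changes_toggle:
  fixes f :: "'a::finite set \<Rightarrow> real"
  assumes inv: "\<And>S. f (toggle i S) = f S"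
  shows "even (card (zeros f))" and "even (card (sign_changes f))"
proof -
  show "even (card (zeros f))"
    by (rule fixpoint_free_involution_even_card[where h = "toggle i"]) (auto simp: zeros_def inv)
  have ins: "f (insert i S) = f S" for S
    using inv[of S] by (cases "i \<in> S") (auto simp: toggle_def insert_absorb)
  have nz: "j \<noteq> i" if "(j, S) \<in> sign_changes f" for j S
    using that ins by (auto simp: sign_changes_def zero_le_square not_less)
  have com: "insert j (toggle i S) = toggle i (insert j S)" if "j \<noteq> i" for j S
    using that by (auto simp: toggle_def)
  show "even (card (sign_changes f))"
  proof (rule fixpoint_free_involution_even_card[where h = "\<lambda>(j, S). (j, toggle i S)"])
    fix p assume p: "p \<in> sign_changes f"
    obtain j S where [simp]: "p = (j, S)" by force
    have ji: "j \<noteq> i" using p nz by simp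
    then have "j \<notin> toggle i S" using p by (auto simp: sign_changes_def toggle_def)
    then show "(case p of (j, S) \<Rightarrow> (j, toggle i S)) \<in> sign_changes f"
      using p ji by (simp add: sign_changes_def inv com)
  qed auto
qed

section \<open>Counting maximal chains\<close>

lemma fact_mult_fact_ge_central:
  assumes "k \<le> n"
  shows "fact (n div 2) * fact (n - n div 2) \<le> (fact k * fact (n - k) :: nat)"
proof -
  have eq: "fact k * fact (n - k) * (n choose k)
     = (fact (n div 2) * fact (n - n div 2) * (n choose (n div 2)) :: nat)"
    using assms by (simp add: binomial_fact_lemma)
  have le: "n choose k \<le> n choose (n div 2)" by (rule binomial_maximum)
  have "0 < n choose k" using assms by simp
  then show ?thesis
    using eq le by (metis mult_le_mono2 mult_le_cancel2)
qed

text \<open>A maximal chain \<open>{} \<subset> ... \<subset> UNIV\<close> is encoded by the list of its successively added elements,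
  and its members are the sets of initial segments of that list.\<close>

definition chains_through :: "'a set \<Rightarrow> 'a list set" where
  "chains_through S = {xs \<in> permutations_of_set UNIV. set (take (card S) xs) = S}"

text \<open>A chain through \<open>S\<close> is an enumeration of \<open>S\<close> followed by one of its complement.\<close>

lemma card_chains_through:
  fixes S :: "'a::finite set"
  shows "card (chains_through S) = fact (card S) * fact (CARD('a) - card S)"
proof -
  have "bij_betw (\<lambda>(ys, zs). ys @ zs) (permutations_of_set S \<times> permutations_of_set (- S)) (chains_through S)"
  proof (rule bij_betw_byWitness[where f' = "\<lambda>xs. (take (card S) xs, drop (card S) xs)"])
    show "(\<lambda>xs. (take (card S) xs, drop (card S) xs)) ` chains_through S
        \<subseteq> permutations_of_set S \<times> permutations_of_set (- S)"
    proof clarsimp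
      fix xs assume "xs \<in> chains_through S"
      then have xs: "set xs = UNIV" "distinct xs" "set (take (card S) xs) = S"
        by (auto simp: chains_through_def permutations_of_set_def)
      have "set (take (card S) xs) \<inter> set (drop (card S) xs) = {}"
        using xs(2) by (simp add: set_take_disj_set_drop_if_distinct)
      moreover have "set (take (card S) xs) \<union> set (drop (card S) xs) = UNIV"
        using xs(1) by (metis append_take_drop_id set_append)
      ultimately show "take (card S) xs \<in> permutations_of_set S \<and> drop (card S) xs \<in> permutations_of_set (- S)"
        using xs by (auto simp: permutations_of_set_def)
    qed
  qed (auto simp: chains_through_def permutations_of_set_def distinct_card)
  then have "card (chains_through S) = card (permutations_of_set S \<times> permutations_of_set (- S))"
    by (simp add: bij_betw_same_card)
  then show ?thesis by (simp add: card_cartesian_product Compl_eq_Diff_UNIV card_Diff_subset)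
qed

text \<open>A chain using the edge from \<open>S\<close> to \<open>insert i S\<close> enumerates \<open>S\<close>, then adds \<open>i\<close>, then enumerates
  the rest.\<close>

lemma card_chains_through_edge:
  fixes S :: "'a::finite set"
  assumes i: "i \<notin> S"
  shows "card (chains_through S \<inter> chains_through (insert i S))
    = fact (card S) * fact (CARD('a) - 1 - card S)"
proof -
  let ?E = "chains_through S \<inter> chains_through (insert i S)"
  let ?T = "- insert i S"
  have "bij_betw (\<lambda>(ys, zs). ys @ i # zs) (permutations_of_set S \<times> permutations_of_set ?T) ?E"
  proof (rule bij_betw_byWitness[where f' = "\<lambda>xs. (take (card S) xs, drop (Suc (card S)) xs)"])
    show "\<forall>xs\<in>?E. (case (take (card S) xs, drop (Suc (card S)) xs) of (ys, zs) \<Rightarrow> ys @ i # zs) = xs"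
    proof clarsimp
      fix xs assume "xs \<in> chains_through S" "xs \<in> chains_through (insert i S)"
      then have xs: "set xs = UNIV" "distinct xs" "set (take (card S) xs) = S"
         "set (take (Suc (card S)) xs) = insert i S"
        using i by (auto simp: chains_through_def permutations_of_set_def)
      have "card (insert i S) \<le> card (UNIV :: 'a set)" by (rule card_mono) auto
      then have l: "card S < length xs" using xs i by (metis Suc_le_eq card_insert_disjoint distinct_card finite)
      have "xs ! card S = i"
        using xs(2,3,4) l i by (auto simp: take_Suc_conv_app_nth)
          (metis insert_iff)
      then show "take (card S) xs @ i # drop (Suc (card S)) xs = xs"
        using id_take_nth_drop[OF l] by simp
    qed
    show "(\<lambda>xs. (take (card S) xs, drop (Suc (card S)) xs)) ` ?E
        \<subseteq> permutations_of_set S \<times> permutations_of_set ?T"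
    proof clarsimp
      fix xs assume "xs \<in> chains_through S" "xs \<in> chains_through (insert i S)"
      then have xs: "set xs = UNIV" "distinct xs" "set (take (card S) xs) = S"
         "set (take (Suc (card S)) xs) = insert i S"
        using i by (auto simp: chains_through_def permutations_of_set_def)
      have "set (take (Suc (card S)) xs) \<inter> set (drop (Suc (card S)) xs) = {}"
        using xs(2) by (simp add: set_take_disj_set_drop_if_distinct)
      moreover have "set (take (Suc (card S)) xs) \<union> set (drop (Suc (card S)) xs) = UNIV"
        using xs(1) by (metis append_take_drop_id set_append)
      ultimately show "take (card S) xs \<in> permutations_of_set S \<and> drop (Suc (card S)) xs \<in> permutations_of_set ?T"
        using xs by (auto simp: permutations_of_set_def)
    qed
    have split: "length ys = card S" "set ys = S" "distinct (ys @ i # zs)" "set zs = ?T"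
      if "ys \<in> permutations_of_set S" "zs \<in> permutations_of_set ?T" for ys zs
      using that i by (auto dest: permutations_of_setD simp: length_finite_permutations_of_set)
    show "\<forall>p\<in>permutations_of_set S \<times> permutations_of_set ?T.
        (\<lambda>xs. (take (card S) xs, drop (Suc (card S)) xs)) (case p of (ys, zs) \<Rightarrow> ys @ i # zs) = p"
      by (auto simp: split(1))
    show "(\<lambda>(ys, zs). ys @ i # zs) ` (permutations_of_set S \<times> permutations_of_set ?T) \<subseteq> ?E"
    proof clarify
      fix ys zs assume "ys \<in> permutations_of_set S" "zs \<in> permutations_of_set ?T"
      note yz = split[OF this]
      have "set (ys @ i # zs) = UNIV" using yz(2,4) by auto
      then have "ys @ i # zs \<in> permutations_of_set UNIV" using yz(3) by (rule permutations_of_setI)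
      then show "ys @ i # zs \<in> ?E" using yz(1,2) i by (simp add: chains_through_def)
    qed
  qed
  then have "card ?E = card (permutations_of_set S \<times> permutations_of_set ?T)"
    by (simp add: bij_betw_same_card)
  then show ?thesis using i by (simp add: card_cartesian_product Compl_eq_Diff_UNIV card_Diff_subset)
qed

lemma chains_through_nested:
  assumes "xs \<in> chains_through S" "xs \<in> chains_through T"
  shows "S \<subseteq> T \<or> T \<subseteq> S"
proof -
  have S: "set (take (card S) xs) = S" and T: "set (take (card T) xs) = T"
    using assms by (auto simp: chains_through_def)
  show ?thesis
    using set_take_subset_set_take[of "card S" "card T" xs]
      set_take_subset_set_take[of "card T" "card S" xs] S T by (metis linorder_linear)
qed

text \<open>The Lubell--Yamamoto--Meshalkin inequality for vertices and edges together. Along a maximal chain a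
  strictly increasing \<open>f\<close> passes from negative to positive values at most once, either in a zero or
  across one edge. The sets of chains through the different zeros and sign-changing edges are
  therefore disjoint, and all of them lie among the \<open>fact CARD('a)\<close> maximal chains.\<close>

lemma LYM_zeros_sign_changes:
  fixes f :: "'a::finite set \<Rightarrow> real"
  assumes mono: "\<And>S T. S \<subset> T \<Longrightarrow> f S < f T"
  shows "(\<Sum>S\<in>zeros f. fact (card S) * fact (CARD('a) - card S))
    + (\<Sum>(i, S)\<in>sign_changes f. fact (card S) * fact (CARD('a) - 1 - card S)) \<le> (fact CARD('a) :: nat)"
proof -
  define Q where "Q = (\<lambda>(i::'a, S). chains_through S \<inter> chains_through (insert i S))"
  have fin: "finite (chains_through S)" for S :: "'a set"
    by (simp add: chains_through_def)
  have change: "f S < 0 \<and> 0 < f (insert i S) \<and> i \<notin> S" if "(i, S) \<in> sign_changes f" for i S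
    using that mono[of S "insert i S"] psubset_insert_iff[of S i S]
    by (auto simp: sign_changes_def mult_less_0_iff)
  have mono': "f S \<le> f T" if "S \<subseteq> T" for S T
    using mono[of S T] that by (cases "S = T") (auto simp: psubset_eq)
  \<comment> \<open>The chains are kept apart as follows: the sets on a common chain are nested, and the order
      in which they are nested has to agree with the order of their values.\<close>
  have disjP: "chains_through S \<inter> chains_through T = {}" if "S \<in> zeros f" "T \<in> zeros f" "S \<noteq> T" for S T
    using that chains_through_nested[of _ S T] mono[of S T] mono[of T S] by (fastforce simp: zeros_def)
  have disjPQ: "chains_through S \<inter> Q p = {}" if S: "S \<in> zeros f" and p: "p \<in> sign_changes f" for S p
  proof (rule ccontr)
    obtain i T where [simp]: "p = (i, T)" by force
    assume "chains_through S \<inter> Q p \<noteq> {}"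
    then have "S \<subseteq> T \<or> T \<subseteq> S" "S \<subseteq> insert i T \<or> insert i T \<subseteq> S"
      using chains_through_nested by (fastforce simp: Q_def)+
    then have "S \<subseteq> T \<or> insert i T \<subseteq> S" by auto
    then show False using change[of i T] p S mono'[of S T] mono'[of "insert i T" S] by (auto simp: zeros_def)
  qed
  have disjQ: "Q p \<inter> Q q = {}" if p: "p \<in> sign_changes f" and q: "q \<in> sign_changes f" and "p \<noteq> q" for p q
  proof (rule ccontr)
    obtain i S where [simp]: "p = (i, S)" by force
    obtain j T where [simp]: "q = (j, T)" by force
    assume "Q p \<inter> Q q \<noteq> {}"
    then have n: "S \<subseteq> T \<or> T \<subseteq> S" "S \<subseteq> insert j T \<or> insert j T \<subseteq> S"
        "insert i S \<subseteq> T \<or> T \<subseteq> insert i S" "insert i S \<subseteq> insert j T \<or> insert j T \<subseteq> insert i S"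
      using chains_through_nested by (fastforce simp: Q_def)+
    have "\<not> insert i S \<subseteq> T" "\<not> insert j T \<subseteq> S"
      using change[of i S] change[of j T] p q mono'[of "insert i S" T] mono'[of "insert j T" S] by auto
    moreover have "i \<notin> S" "j \<notin> T" using change p q by auto
    ultimately have "S = T" "i = j" using n by blast+
    then show False using \<open>p \<noteq> q\<close> by simp
  qed
  have "(\<Sum>S\<in>zeros f. fact (card S) * fact (CARD('a) - card S))
    + (\<Sum>(i, S)\<in>sign_changes f. fact (card S) * fact (CARD('a) - 1 - card S))
    = (\<Sum>S\<in>zeros f. card (chains_through S)) + (\<Sum>p\<in>sign_changes f. card (Q p))"
    by (intro arg_cong2[where f = "(+)"] sum.cong refl)
      (auto simp: card_chains_through Q_def card_chains_through_edge sign_changes_def simp del: diff_diff_left)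
  also have "\<dots> = card (\<Union>S\<in>zeros f. chains_through S) + card (\<Union>p\<in>sign_changes f. Q p)"
    using disjP disjQ fin by (subst (1 2) card_UN_disjoint) (auto simp: Q_def)
  also have "\<dots> = card ((\<Union>S\<in>zeros f. chains_through S) \<union> (\<Union>p\<in>sign_changes f. Q p))"
    using disjPQ fin by (subst card_Un_disjoint) (auto simp: Q_def)
  also have "\<dots> \<le> card (permutations_of_set (UNIV :: 'a set))"
    by (rule card_mono) (auto simp: Q_def chains_through_def)
  finally show ?thesis by simp
qed

section \<open>Reducing to positive weights\<close>

definition reflect_set :: "'a set \<Rightarrow> 'a set \<Rightarrow> 'a set" where
  "reflect_set N S = (S - N) \<union> (N - S)"

lemma reflect_set_involution [simp]: "reflect_set N (reflect_set N S) = S"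
  by (auto simp: reflect_set_def)

lemma card_zeros_reflect:
  fixes f :: "'a::finite set \<Rightarrow> real"
  shows "card (zeros (\<lambda>S. f (reflect_set N S))) = card (zeros f)"
  by (rule bij_betw_same_card[where f = "reflect_set N"],
      rule bij_betw_byWitness[where f' = "reflect_set N"]) (auto simp: zeros_def)

text \<open>The map on subsets that corresponds to the reflections \<open>x\<^sub>i \<mapsto> 1 - x\<^sub>i\<close>, \<open>i \<in> N\<close>, is an
  automorphism of the cube graph. It exchanges the ends of an edge whose direction lies in \<open>N\<close>, so
  the name of the edge has to be recomputed from the end that avoids its direction. As the
  reflection is an involution, comparing the counts in one direction is enough.\<close>

lemma card_sign_changes_reflect:
  fixes f :: "'a::finite set \<Rightarrow> real"
  shows "card (sign_changes (\<lambda>S. f (reflect_set N S))) = card (sign_changes f)"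
proof -
  let ?r = "\<lambda>(i, S). (i, reflect_set N S - {i})"
  have le: "card (sign_changes g) \<le> card (sign_changes h)"
    if gh: "\<And>S. g S = h (reflect_set N S)" for g h :: "'a set \<Rightarrow> real"
  proof (rule card_inj_on_le[where f = ?r])
    have "?r (?r p) = p" if "p \<in> sign_changes g" for p
      using that by (auto simp: sign_changes_def reflect_set_def)
    then show "inj_on ?r (sign_changes g)" by (rule inj_on_inverseI)
    show "?r ` sign_changes g \<subseteq> sign_changes h"
    proof clarsimp
      fix i S assume "(i, S) \<in> sign_changes g"
      then have "i \<notin> S" and neg: "h (reflect_set N S) * h (reflect_set N (insert i S)) < 0"
        by (auto simp: sign_changes_def gh)
      have "{reflect_set N S, reflect_set N (insert i S)}
        = {reflect_set N S - {i}, insert i (reflect_set N S - {i})}"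
        using \<open>i \<notin> S\<close> by (cases "i \<in> N") (auto simp: reflect_set_def)
      then show "(i, reflect_set N S - {i}) \<in> sign_changes h"
        using neg by (auto simp: sign_changes_def doubleton_eq_iff mult.commute)
    qed
  qed simp
  show ?thesis by (rule antisym; rule le) simp_all
qed

text \<open>The value of the linear form minus its level \<open>b\<close> at the cube vertex with support \<open>S\<close>.\<close>

definition affine_sum :: "('a \<Rightarrow> real) \<Rightarrow> real \<Rightarrow> 'a set \<Rightarrow> real" where
  "affine_sum w b S = sum w S - b"

text \<open>Reflecting the coordinates of negative weight makes all weights nonnegative, at the price of a
  shifted level.\<close>

lemma affine_sum_reflect:
  fixes w :: "'a::finite \<Rightarrow> real"
  defines "N \<equiv> {i. w i < 0}"
  shows "affine_sum w b (reflect_set N S) = affine_sum (\<lambda>i. \<bar>w i\<bar>) (b - sum w N) S"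
proof -
  have "sum w (reflect_set N S) = sum w (S - N) + sum w (N - S)"
    unfolding reflect_set_def by (rule sum.union_disjoint) auto
  moreover have "sum w N = sum w (N - S) + sum w (N \<inter> S)"
    by (subst sum.union_disjoint[symmetric]) (auto intro: arg_cong2[where f=sum])
  moreover have "sum (\<lambda>i. \<bar>w i\<bar>) S = sum (\<lambda>i. \<bar>w i\<bar>) (S - N) + sum (\<lambda>i. \<bar>w i\<bar>) (N \<inter> S)"
    by (subst sum.union_disjoint[symmetric]) (auto intro: arg_cong2[where f=sum])
  moreover have "sum (\<lambda>i. \<bar>w i\<bar>) (S - N) = sum w (S - N)"
    by (rule sum.cong) (auto simp: N_def)
  moreover have "sum (\<lambda>i. \<bar>w i\<bar>) (N \<inter> S) = - sum w (N \<inter> S)"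
    by (subst sum_negf[symmetric], rule sum.cong) (auto simp: N_def)
  ultimately show ?thesis by (simp add: affine_sum_def)
qed

section \<open>The combinatorial gap\<close>

text \<open>In the chain inequality the factorial weights are least in the middle of the cube, by the
  maximality of the central binomial coefficient: a vertex weighs at least \<open>(h!)\<^sup>2 = h * g\<close> and an
  edge at least \<open>g = h! (h - 1)!\<close>. Hence a zero costs \<open>h\<close> times as much as a sign change. The
  budget \<open>(2h)!\<close> divided by \<open>g\<close> is \<open>h * (2 * h choose h)\<close>.\<close>

lemma zeros_sign_changes_bound:
  fixes f :: "'a::finite set \<Rightarrow> real"
  assumes d: "CARD('a) = 2 * h" "h > 0"
    and mono: "\<And>S T. S \<subset> T \<Longrightarrow> f S < f T"
  shows "h * card (zeros f) + card (sign_changes f) \<le> h * (2 * h choose h)"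
proof -
  define g :: nat where "g = fact h * fact (h - 1)"
  have hh: "fact h * fact h = h * g"
    using d(2) by (simp add: g_def fact_reduce)
  have zero_weight: "h * g \<le> fact (card S) * fact (CARD('a) - card S)" for S :: "'a set"
  proof -
    have "card S \<le> 2 * h" using card_mono[of UNIV S] d by simp
    from fact_mult_fact_ge_central[OF this] show ?thesis by (simp add: d hh)
  qed
  have change_weight: "g \<le> fact (card S) * fact (CARD('a) - 1 - card S)" if "i \<notin> S" for i :: 'a and S
  proof -
    have "card (insert i S) \<le> 2 * h" using card_mono[of UNIV "insert i S"] d by simp
    then have "card S \<le> 2 * h - 1" using that by simp
    from fact_mult_fact_ge_central[OF this]
    have "fact ((2 * h - 1) div 2) * fact (2 * h - 1 - (2 * h - 1) div 2)
       \<le> (fact (card S) * fact (2 * h - 1 - card S) :: nat)" .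
    moreover have "(2 * h - 1) div 2 = h - 1" "2 * h - 1 - (h - 1) = h" using d(2) by auto
    ultimately show ?thesis by (simp add: d g_def mult.commute)
  qed
  have "g * (h * card (zeros f) + card (sign_changes f))
      = (\<Sum>S\<in>zeros f. h * g) + (\<Sum>(i, S)\<in>sign_changes f. g)"
    by (simp add: algebra_simps split_def)
  also have "\<dots> \<le> (\<Sum>S\<in>zeros f. fact (card S) * fact (CARD('a) - card S))
      + (\<Sum>(i, S)\<in>sign_changes f. fact (card S) * fact (CARD('a) - 1 - card S))"
    using zero_weight change_weight
    by (intro add_mono sum_mono) (auto simp: sign_changes_def simp del: diff_diff_left)
  also have "\<dots> \<le> fact CARD('a)" by (rule LYM_zeros_sign_changes) (rule mono)
  also have "\<dots> = g * (h * (2 * h choose h))"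
    using binomial_fact_lemma[of h "2 * h"] hh d by (simp add: mult.assoc mult.left_commute)
  finally show ?thesis using mult_le_cancel1 by (simp add: g_def)
qed

text \<open>An odd count rules out a vanishing weight and an empty set of zeros. In the remaining
  case there is at least one zero, and since a zero uses up the room of \<open>h\<close> sign changes but
  contributes only one to the count, the count is at most \<open>Suc m - (h - 1)\<close>. This is less than \<open>m\<close>
  precisely because \<open>h > 2\<close>.\<close>

lemma zeros_sign_changes_count_neq:
  fixes w :: "'a::finite \<Rightarrow> real"
  assumes d: "CARD('a) = 2 * h" and h: "h > 2" and m: "odd m" "Suc m = h * (2 * h choose h)"
  shows "card (zeros (affine_sum w b)) + card (sign_changes (affine_sum w b)) \<noteq> m"
proof (cases "\<exists>i. w i = 0")
  case True
  then obtain i where i: "w i = 0" by blast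
  have "sum w (toggle i S) = sum w S" for S
    using i by (auto simp: toggle_def sum_diff1 sum.insert_if)
  then have "affine_sum w b (toggle i S) = affine_sum w b S" for S
    by (simp add: affine_sum_def)
  from even_card_zeros_sign_changes_toggle[of "affine_sum w b", OF this]
  show ?thesis using m(1) by auto
next
  case False
  define f where "f = affine_sum (\<lambda>i. \<bar>w i\<bar>) (b - sum w {i. w i < 0})"
  have f: "f = (\<lambda>S. affine_sum w b (reflect_set {i. w i < 0} S))"
    by (auto simp: f_def affine_sum_reflect)
  have eq: "card (zeros (affine_sum w b)) + card (sign_changes (affine_sum w b))
     = card (zeros f) + card (sign_changes f)"
    unfolding f by (simp add: card_zeros_reflect card_sign_changes_reflect)
  have mono: "f S < f T" if ST: "S \<subset> T" for S T
  proof -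
    obtain i where "i \<in> T - S" using ST by blast
    then have "(\<Sum>i\<in>S. \<bar>w i\<bar>) < (\<Sum>i\<in>T. \<bar>w i\<bar>)"
      using ST False by (intro sum_strict_mono2[where b = i]) auto
    then show ?thesis by (simp add: f_def affine_sum_def)
  qed
  show ?thesis
  proof (cases "zeros f = {}")
    case True
    then show ?thesis using even_card_sign_changes[of f] d m(1) eq by auto
  next
    case False
    then have "card (zeros f) > 0" by (simp add: card_gt_0_iff)
    moreover have "h * card (zeros f) + card (sign_changes f) \<le> Suc m"
      using zeros_sign_changes_bound[OF d _ mono] h m(2) by simp
    moreover have "h * card (zeros f) \<ge> 3 * card (zeros f)" using h by simp
    ultimately show ?thesis using eq by linarith
  qed
qed

text \<open>The hyperplane halfway between the levels \<open>h - 1\<close> and \<open>h\<close> crosses exactly the edges between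
  these levels, and each of the sets of size \<open>h - 1\<close> is the lower end of \<open>h + 1\<close> of them.\<close>

lemma card_zeros_sign_changes_middle:
  assumes d: "CARD('a::finite) = 2 * h" and h: "h > 0"
  defines "f \<equiv> affine_sum (\<lambda>_::'a. 1) (real h - 1 / 2)"
  shows "zeros f = {}" and "card (sign_changes f) = h * (2 * h choose h)"
proof -
  have f: "f S = real (card S) - real h + 1 / 2" for S
    by (simp add: f_def affine_sum_def)
  have nz: "f S \<noteq> 0" for S
  proof
    assume "f S = 0"
    then have "real (2 * card S + 1) = real (2 * h)" by (simp add: f)
    then have "2 * card S + 1 = 2 * h" by (simp only: of_nat_eq_iff)
    then show False by presburger
  qed
  then show "zeros f = {}" by (simp add: zeros_def)
  have neg: "f S < 0 \<longleftrightarrow> card S < h" for S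
  proof -
    have "f S < 0 \<longleftrightarrow> real (2 * card S + 1) < real (2 * h)" by (auto simp: f)
    also have "\<dots> \<longleftrightarrow> card S < h" by (simp only: of_nat_less_iff) presburger
    finally show ?thesis .
  qed
  have change: "(i, S) \<in> sign_changes f \<longleftrightarrow> S \<in> {S. card S = h - 1} \<and> i \<in> - S" for i S
  proof -
    have "f S * f (insert i S) < 0 \<longleftrightarrow> (f S < 0) \<noteq> (f (insert i S) < 0)"
      using nz[of S] nz[of "insert i S"] by (auto simp: mult_less_0_iff)
    then show ?thesis using h by (auto simp: sign_changes_def neg)
  qed
  have "bij_betw prod.swap (Sigma {S. card S = h - 1} uminus) (sign_changes f)"
    by (rule bij_betw_byWitness[where f' = prod.swap]) (auto simp: change)
  then have "card (sign_changes f) = card (Sigma {S :: 'a set. card S = h - 1} uminus)"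
    by (simp add: bij_betw_same_card)
  also have "\<dots> = (\<Sum>S | card (S :: 'a set) = h - 1. card (- S))"
    by (rule card_SigmaI) auto
  also have "\<dots> = (\<Sum>S | card (S :: 'a set) = h - 1. h + 1)"
    using h d by (intro sum.cong) (auto simp: Compl_eq_Diff_UNIV card_Diff_subset)
  also have "\<dots> = (h + 1) * (2 * h choose (h - 1))"
    using n_subsets[of "UNIV :: 'a set" "h - 1"] d by simp
  also have "\<dots> = h * (2 * h choose h)"
  proof -
    have "h * (2 * h choose h) = 2 * h * (2 * h - 1 choose (h - 1))"
      using times_binomial_minus1_eq[of h "2 * h"] h by simp
    moreover have "(h + 1) * (2 * h choose (h - 1)) = 2 * h * (2 * h - 1 choose (h - 1))"
      using binomial_absorb_comp[of "2 * h" "h - 1"] h by (simp add: diff_diff_right)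
    ultimately show ?thesis by linarith
  qed
  finally show "card (sign_changes f) = h * (2 * h choose h)" .
qed

section \<open>Vertices of a hyperplane slice of the cube\<close>

definition slice :: "real ^ 'n \<Rightarrow> real \<Rightarrow> (real ^ 'n) set" where
  "slice a b = {x. a \<bullet> x = b} \<inter> hypercube"

lemma hypercube_eq: "hypercube = {x :: real ^ 'n. \<forall>k. 0 \<le> x $ k \<and> x $ k \<le> 1}"
proof -
  have "hypercube = cbox (0 :: real ^ 'n) 1"
    unfolding hypercube_def Cart_1 unit_interval_convex_hull
    by (rule arg_cong[where f = "\<lambda>x. convex hull x"]) (simp add: Basis_vec_def inner_axis)
  then show ?thesis by (simp add: set_eq_iff mem_box_cart)
qed

lemma in_slice_iff:
  "x \<in> slice a b \<longleftrightarrow> a \<bullet> x = b \<and> (\<forall>k. 0 \<le> x $ k \<and> x $ k \<le> 1)"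
  by (simp add: slice_def hypercube_eq)

definition fractional :: "real ^ 'n \<Rightarrow> 'n set" where
  "fractional x = {k. 0 < x $ k \<and> x $ k < 1}"

text \<open>A vertex of the slice cannot be moved in two opposite directions within the slice. A direction in
  the hyperplane that changes only coordinates strictly between 0 and 1 could be followed both ways
  for a short while.\<close>

lemma slice_vertex_rigid:
  fixes v :: "real ^ 'n"
  assumes x: "x extreme_point_of (slice a b)"
    and v: "a \<bullet> v = 0" "\<And>k. k \<notin> fractional x \<Longrightarrow> v $ k = 0"
  shows "v = 0"
proof (rule ccontr)
  assume "v \<noteq> 0"
  \<comment> \<open>The step length is the smallest, over all coordinates, of the distance to the
      nearer face of the cube relative to the speed in that coordinate.\<close>
  define \<epsilon> where "\<epsilon> k = (if v $ k = 0 then 1 else min (x $ k) (1 - x $ k) / \<bar>v $ k\<bar>)" for k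
  define e where "e = Min (range \<epsilon>)"
  have "\<epsilon> k > 0" for k
  proof (cases "v $ k = 0")
    case False
    then have "k \<in> fractional x" using v(2) by blast
    then show ?thesis using False by (simp add: \<epsilon>_def fractional_def)
  qed (simp add: \<epsilon>_def)
  then have "e > 0" unfolding e_def by (subst Min_gr_iff) auto
  have x_in: "a \<bullet> x = b" "0 \<le> x $ k" "x $ k \<le> 1" for k
    using x by (auto simp: extreme_point_of_def in_slice_iff)
  have small: "\<bar>e * v $ k\<bar> \<le> min (x $ k) (1 - x $ k)" for k
  proof (cases "v $ k = 0")
    case False
    have "e \<le> \<epsilon> k" unfolding e_def by (rule Min_le) auto
    then have "e * \<bar>v $ k\<bar> \<le> min (x $ k) (1 - x $ k)"
      using False by (simp add: \<epsilon>_def pos_le_divide_eq del: min_less_iff_conj)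
    then show ?thesis using \<open>e > 0\<close> by (simp add: abs_mult)
  qed (use x_in in auto)
  let ?y = "x - e *\<^sub>R v" and ?z = "x + e *\<^sub>R v"
  have "?y \<in> slice a b" "?z \<in> slice a b"
    using x_in(1) v(1) small by (auto simp: in_slice_iff inner_simps abs_le_iff; smt (verit))+
  moreover have "x \<in> open_segment ?y ?z"
  proof -
    have "?y \<noteq> ?z" using \<open>e > 0\<close> \<open>v \<noteq> 0\<close> by (auto simp: algebra_simps scaleR_2[symmetric])
    moreover have "x = (1 - 1/2) *\<^sub>R ?y + (1/2) *\<^sub>R ?z"
      by (simp add: algebra_simps flip: scaleR_add_left)
    ultimately show ?thesis
      unfolding in_segment by (intro conjI exI[of _ "1/2"]) auto
  qed
  ultimately show False using x by (auto simp: extreme_point_of_def)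
qed

text \<open>Two fractional coordinates could be traded against each other inside the hyperplane, and one
  fractional coordinate of weight 0 could be moved freely.\<close>

lemma slice_vertex_fractional:
  fixes a :: "real ^ 'n"
  assumes x: "x extreme_point_of (slice a b)" and i: "i \<in> fractional x"
  shows "a $ i \<noteq> 0" and "fractional x = {i}"
proof -
  have nz: "a $ k \<noteq> 0" if "k \<in> fractional x" for k
  proof
    assume "a $ k = 0"
    then have "axis k (1::real) = 0"
      using that by (intro slice_vertex_rigid[OF x]) (auto simp: inner_axis, auto simp: axis_def)
    then show False by (simp add: axis_eq_0_iff)
  qed
  then show "a $ i \<noteq> 0" using i .
  have "j = i" if j: "j \<in> fractional x" for j
  proof (rule ccontr)
    assume "j \<noteq> i"
    have "axis i (a $ j) - axis j (a $ i) = 0"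
      using i j by (intro slice_vertex_rigid[OF x])
        (auto simp: inner_axis inner_diff_right, auto simp: axis_def)
    then have "(axis i (a $ j) - axis j (a $ i)) $ i = 0" by simp
    then show False using \<open>j \<noteq> i\<close> nz[OF j] by (simp add: axis_def)
  qed
  then show "fractional x = {i}" using i by blast
qed

text \<open>Coordinates equal to 0 or 1 agree for all points of a segment around \<open>x\<close> in the cube; if at most
  one coordinate is left, the equation of the hyperplane determines it.\<close>

lemma slice_vertexI:
  fixes a :: "real ^ 'n"
  assumes x: "x \<in> slice a b" and sub: "fractional x \<subseteq> {i}" and i: "a $ i \<noteq> 0 \<or> fractional x = {}"
  shows "x extreme_point_of (slice a b)"
  unfolding extreme_point_of_def
proof (intro conjI ballI notI)
  fix y z assume y: "y \<in> slice a b" and z: "z \<in> slice a b" and "x \<in> open_segment y z"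
  then obtain t where t: "0 < t" "t < 1" and xt: "x = (1 - t) *\<^sub>R y + t *\<^sub>R z" and "y \<noteq> z"
    by (auto simp: in_segment)
  have eq: "y $ k = z $ k" if nf: "k \<notin> fractional x" for k
  proof -
    have xk: "x $ k = (1 - t) * y $ k + t * z $ k" by (simp add: xt)
    have b: "0 \<le> y $ k" "y $ k \<le> 1" "0 \<le> z $ k" "z $ k \<le> 1" "0 \<le> x $ k" "x $ k \<le> 1"
      using x y z by (auto simp: in_slice_iff)
    then consider "x $ k = 0" | "x $ k = 1"
      using nf unfolding fractional_def by fastforce
    then show ?thesis
    proof cases
      case 1
      then have "(1 - t) * y $ k = 0" "t * z $ k = 0"
        using b t xk by (smt (verit) mult_nonneg_nonneg)+
      then show ?thesis using t by simp
    next
      case 2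
      then have "(1 - t) * (1 - y $ k) + t * (1 - z $ k) = 0"
        using xk by (simp add: algebra_simps)
      then have "(1 - t) * (1 - y $ k) = 0" "t * (1 - z $ k) = 0"
        using b t by (smt (verit) mult_nonneg_nonneg)+
      then show ?thesis using t by simp
    qed
  qed
  have "y = z"
  proof (cases "fractional x = {}")
    case True
    then show ?thesis using eq by (simp add: vec_eq_iff)
  next
    case False
    then have "a $ i \<noteq> 0" using i by simp
    have "a \<bullet> (y - z) = 0" using y z by (simp add: in_slice_iff inner_diff_right)
    moreover have "a \<bullet> (y - z) = (\<Sum>k\<in>{i}. a $ k * (y $ k - z $ k))"
      unfolding inner_vec_def using eq sub by (intro sum.mono_neutral_cong_right) auto
    ultimately have "y $ i = z $ i" using \<open>a $ i \<noteq> 0\<close> by simp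
    then show ?thesis using eq sub by (auto simp: vec_eq_iff)
  qed
  then show False using \<open>y \<noteq> z\<close> by simp
qed (rule x)

definition corner :: "'n::finite set \<Rightarrow> real ^ 'n" where
  "corner S = (\<chi> k. if k \<in> S then 1 else 0)"

lemma inner_corner: "a \<bullet> corner S = sum (($) a) S"
  by (simp add: inner_vec_def corner_def if_distrib sum.If_cases cong: if_cong)

text \<open>The point in which the hyperplane meets the line through the edge in direction \<open>i\<close> at the corner
  \<open>S\<close>.\<close>

definition edge_point :: "real ^ 'n \<Rightarrow> real \<Rightarrow> 'n::finite \<times> 'n set \<Rightarrow> real ^ 'n" where
  "edge_point a b = (\<lambda>(i, S). corner S + axis i ((b - sum (($) a) S) / a $ i))"

text \<open>With \<open>u\<close> and \<open>u + c\<close> the values of the affine form at the ends of an edge, \<open>- u / c\<close> is the position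
  of its root on the edge: the root lies in the interior if and only if the values have opposite
  signs.\<close>

lemma edge_parameter_iff:
  fixes u c :: real
  assumes "c \<noteq> 0"
  shows "0 < (- u) / c \<and> (- u) / c < 1 \<longleftrightarrow> u * (u + c) < 0"
proof (cases "c > 0")
  case True
  then have "- u / c < 1 \<longleftrightarrow> 0 < u + c" "0 < - u / c \<longleftrightarrow> u < 0"
    using pos_divide_less_eq[of c "- u" 1] pos_less_divide_eq[of c 0 "- u"] by linarith+
  then show ?thesis unfolding mult_less_0_iff using True by linarith
next
  case False
  then have "c < 0" using assms by simp
  then have "- u / c < 1 \<longleftrightarrow> u + c < 0" "0 < - u / c \<longleftrightarrow> 0 < u"
    using neg_divide_less_eq[of c "- u" 1] neg_less_divide_eq[of c 0 "- u"] by linarith+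
  then show ?thesis unfolding mult_less_0_iff using \<open>c < 0\<close> by linarith
qed

lemma slice_vertices:
  fixes a :: "real ^ 'n" and b :: real
  defines "f \<equiv> affine_sum (($) a) b"
  shows "polytope_vertices (slice a b) = corner ` zeros f \<union> edge_point a b ` sign_changes f"
    (is "?V = ?C \<union> ?E")
proof
  have fins: "f (insert i S) = f S + a $ i" if "i \<notin> S" for i S
    using that by (simp add: f_def affine_sum_def)
  have bS: "b - sum (($) a) S = - f S" for S by (simp add: f_def affine_sum_def)
  show "?V \<subseteq> ?C \<union> ?E"
  proof
    fix x assume "x \<in> ?V"
    then have x: "x extreme_point_of (slice a b)" by (simp add: polytope_vertices_def)
    then have xin: "a \<bullet> x = b" "0 \<le> x $ k" "x $ k \<le> 1" for k
      by (auto simp: extreme_point_of_def in_slice_iff)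
    define S where "S = {k. x $ k = 1}"
    have val: "x $ k = corner S $ k" if "k \<notin> fractional x" for k
      using that xin(2,3)[of k] by (auto simp: corner_def S_def fractional_def)
    show "x \<in> ?C \<union> ?E"
    proof (cases "fractional x = {}")
      case True
      then have xS: "x = corner S" using val by (simp add: vec_eq_iff)
      then have "S \<in> zeros f" using xin(1) by (simp add: zeros_def f_def affine_sum_def inner_corner)
      then show ?thesis using xS by auto
    next
      case False
      then obtain i where i: "i \<in> fractional x" by auto
      note ai = slice_vertex_fractional[OF x i]
      have "i \<notin> S" using i by (auto simp: S_def fractional_def)
      have xS: "x = corner S + axis i (x $ i)"
        using val ai(2) \<open>i \<notin> S\<close> by (auto simp: vec_eq_iff axis_def corner_def)
      have "a \<bullet> x = sum (($) a) S + a $ i * x $ i"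
        by (subst xS) (simp add: inner_add_right inner_corner inner_axis)
      then have xi: "x $ i = - f S / a $ i"
        using xin(1) ai(1) by (simp add: f_def affine_sum_def field_simps)
      then have "f S * f (insert i S) < 0"
        using i edge_parameter_iff[OF ai(1), of "f S"] fins[OF \<open>i \<notin> S\<close>] by (simp add: fractional_def)
      then have "(i, S) \<in> sign_changes f" using \<open>i \<notin> S\<close> by (simp add: sign_changes_def)
      moreover have "x = edge_point a b (i, S)" using xS xi by (simp add: edge_point_def bS)
      ultimately show ?thesis by blast
    qed
  qed
  show "?C \<union> ?E \<subseteq> ?V"
  proof -
    have "corner S \<in> ?V" if "S \<in> zeros f" for S
    proof -
      have "corner S \<in> slice a b"
        using that by (auto simp: in_slice_iff inner_corner zeros_def f_def affine_sum_def)
          (auto simp: corner_def)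
      moreover have "fractional (corner S) = {}" by (auto simp: fractional_def corner_def)
      ultimately show ?thesis by (simp add: polytope_vertices_def slice_vertexI)
    qed
    moreover have "edge_point a b (i, S) \<in> ?V" if "(i, S) \<in> sign_changes f" for i S
    proof -
      have "i \<notin> S" and neg: "f S * f (insert i S) < 0" using that by (auto simp: sign_changes_def)
      then have "a $ i \<noteq> 0" using fins[of i S] by (auto simp: mult_less_0_iff)
      define t where "t = - f S / a $ i"
      have t: "0 < t" "t < 1"
        using edge_parameter_iff[OF \<open>a $ i \<noteq> 0\<close>, of "f S"] neg fins[OF \<open>i \<notin> S\<close>] by (auto simp: t_def)
      have p: "edge_point a b (i, S) = corner S + axis i t" by (simp add: edge_point_def bS t_def)
      have "a \<bullet> (corner S + axis i t) = b"
        using \<open>a $ i \<noteq> 0\<close> bS[of S] by (simp add: inner_add_right inner_corner inner_axis t_def)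
      then have "corner S + axis i t \<in> slice a b"
        using t \<open>i \<notin> S\<close> by (auto simp: in_slice_iff corner_def axis_def)
      moreover have "fractional (corner S + axis i t) \<subseteq> {i}"
        by (auto simp: fractional_def corner_def axis_def split: if_splits)
      ultimately show ?thesis
        using \<open>a $ i \<noteq> 0\<close> by (simp add: p polytope_vertices_def slice_vertexI)
    qed
    ultimately show ?thesis by auto
  qed
qed

text \<open>A vertex of the slice determines the corner or the edge that it comes from: the direction of the
  edge is its fractional coordinate, and the set is given by the coordinates equal to 1.\<close>

lemma cv_eq_zeros_sign_changes:
  fixes a :: "real ^ 'n" and b :: real
  defines "f \<equiv> affine_sum (($) a) b"
  shows "cv hypercube {x. a \<bullet> x = b} = card (zeros f) + card (sign_changes f)"
proof -
  have frac: "fractional (edge_point a b (i, S)) = {i} \<and> {k. edge_point a b (i, S) $ k = 1} = S"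
    if "(i, S) \<in> sign_changes f" for i S
  proof -
    have "i \<notin> S" and neg: "f S * f (insert i S) < 0" using that by (auto simp: sign_changes_def)
    have fi: "f (insert i S) = f S + a $ i" using \<open>i \<notin> S\<close> by (simp add: f_def affine_sum_def)
    then have "a $ i \<noteq> 0" using neg by (auto simp: mult_less_0_iff)
    define t where "t = - f S / a $ i"
    have t: "0 < t" "t < 1"
      using edge_parameter_iff[OF \<open>a $ i \<noteq> 0\<close>, of "f S"] neg fi by (auto simp: t_def)
    have "edge_point a b (i, S) = corner S + axis i t"
      by (simp add: edge_point_def t_def f_def affine_sum_def)
    then show ?thesis using t \<open>i \<notin> S\<close> by (auto simp: fractional_def corner_def axis_def)
  qed
  have inj_corner: "inj_on corner (zeros f)"
    by (rule inj_on_inverseI[where g = "\<lambda>x. {k. x $ k = 1}"]) (auto simp: corner_def)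
  have inj_edge: "inj_on (edge_point a b) (sign_changes f)"
    by (rule inj_on_inverseI[where g = "\<lambda>x. (the_elem (fractional x), {k. x $ k = 1})"])
      (use frac in auto)
  have disj: "corner ` zeros f \<inter> edge_point a b ` sign_changes f = {}"
  proof -
    have "fractional (corner S) = {}" for S :: "'n set" by (auto simp: fractional_def corner_def)
    then show ?thesis using frac by (metis (no_types, lifting) disjoint_iff imageE insert_not_empty prod.exhaust)
  qed
  have "cv hypercube {x. a \<bullet> x = b} = card (corner ` zeros f \<union> edge_point a b ` sign_changes f)"
    by (simp add: cv_def slice_vertices f_def flip: slice_def)
  also have "\<dots> = card (zeros f) + card (sign_changes f)"
    using disj inj_corner inj_edge by (simp add: card_Un_disjoint card_image)
  finally show ?thesis .
qed

section \<open>The gap\<close>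

lemma vertex_slice_sequence_hypercubeE:
  assumes "m \<in> vertex_slice_sequence (hypercube :: (real ^ 'n::finite) set)"
  obtains w :: "'n::finite \<Rightarrow> real" and b
  where "m = card (zeros (affine_sum w b)) + card (sign_changes (affine_sum w b))"
proof -
  from assms obtain H :: "(real ^ 'n) set"
    where "H \<in> hyperplanes_meeting hypercube" and m: "m = cv hypercube H"
    unfolding vertex_slice_sequence_def by (rule imageE)
  then obtain a :: "real ^ 'n" and b where "H = {x. a \<bullet> x = b}"
    unfolding hyperplanes_meeting_def by blast
  then show thesis using m that by (simp only: cv_eq_zeros_sign_changes)
qed

lemma finite_vertex_slice_sequence_hypercube:
  "finite (vertex_slice_sequence (hypercube :: (real ^ 'n) set))"
proof (rule finite_subset)
  show "vertex_slice_sequence (hypercube :: (real ^ 'n) set)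
    \<subseteq> {.. card (UNIV :: 'n set set) + card (UNIV :: ('n \<times> 'n set) set)}"
  proof
    fix m assume "m \<in> vertex_slice_sequence (hypercube :: (real ^ 'n) set)"
    then obtain w :: "'n \<Rightarrow> real" and b
      where m: "m = card (zeros (affine_sum w b)) + card (sign_changes (affine_sum w b))"
      by (rule vertex_slice_sequence_hypercubeE)
    show "m \<in> {.. card (UNIV :: 'n set set) + card (UNIV :: ('n \<times> 'n set) set)}"
      unfolding m atMost_iff by (intro add_mono card_mono finite subset_UNIV)
  qed
qed (rule finite_atMost)

theorem theorem1p5:
  fixes d :: nat
  assumes "d = CARD('n::finite)" and "even d" and "d > 4"
  shows "is_gap (hypercube :: (real ^ 'n) set) ((d div 2) * (d choose (d div 2)) - 1)"
proof -
  define h where "h = d div 2"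
  define M where "M = h * (2 * h choose h)"
  have d: "CARD('n) = 2 * h" "d = 2 * h" and h: "h > 2" using assms by (auto simp: h_def)
  have "M > 0" using h by (simp add: M_def)
  let ?f = "affine_sum (\<lambda>_::'n. 1) (real h - 1 / 2)"
  let ?H = "{x. (1 :: real ^ 'n) \<bullet> x = real h - 1 / 2}"
  have mid: "zeros ?f = {}" "card (sign_changes ?f) = M"
    using card_zeros_sign_changes_middle[OF d(1)] h by (auto simp: M_def)
  have "even M" using even_card_sign_changes[of ?f] mid d by simp
  have "($) (1 :: real ^ 'n) = (\<lambda>_. 1)" by (rule ext) simp
  then have cvH: "cv hypercube ?H = M" by (simp add: cv_eq_zeros_sign_changes mid)
  then have "?H \<inter> hypercube \<noteq> {}"
    using \<open>M > 0\<close> by (metis cv_def polytope_vertices_def extreme_point_of_def card.empty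
        Collect_empty_eq empty_iff less_numeral_extra(3))
  moreover have "(1 :: real ^ 'n) \<noteq> 0" by (simp add: vec_eq_iff)
  ultimately have "?H \<in> hyperplanes_meeting hypercube"
    unfolding hyperplanes_meeting_def by blast
  then have "M \<in> vertex_slice_sequence (hypercube :: (real ^ 'n) set)"
    using cvH by (force simp: vertex_slice_sequence_def)
  then have "M \<le> max_vertex_slice (hypercube :: (real ^ 'n) set)"
    unfolding max_vertex_slice_def by (rule Max_ge[OF finite_vertex_slice_sequence_hypercube])
  moreover have "odd (M - 1)" "Suc (M - 1) = M" using \<open>even M\<close> \<open>M > 0\<close> by auto
  moreover have "M - 1 \<notin> vertex_slice_sequence (hypercube :: (real ^ 'n) set)"
  proof
    assume "M - 1 \<in> vertex_slice_sequence (hypercube :: (real ^ 'n) set)"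
    then obtain w :: "'n \<Rightarrow> real" and b
      where "M - 1 = card (zeros (affine_sum w b)) + card (sign_changes (affine_sum w b))"
      by (rule vertex_slice_sequence_hypercubeE)
    then show False
      using zeros_sign_changes_count_neq[OF d(1) h, of "M - 1" w b] \<open>odd (M - 1)\<close> \<open>Suc (M - 1) = M\<close>
      by (simp add: M_def)
  qed
  ultimately have "is_gap (hypercube :: (real ^ 'n) set) (M - 1)"
    unfolding is_gap_def using odd_pos[OF \<open>odd (M - 1)\<close>] by linarith
  then show ?thesis by (simp add: M_def d(2))
qed

end
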